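(* Let $n\ge 3$. The maximum, over all starting sequences $S_0\in\mathbb{S}_n$ with $S_0\ne R_n$, of the number of jumps (that is, passages from $S_l$ to $S_{l+1}$) that the Algorithm performs before stopping at $R_n$ is $\frac{1}{2}d(R_n,Tr_n)$, where $Tr_n=(0,1,2,\dots,n-1)$; this equals $\frac{n^2-1}{8}$ if $n$ is odd and $\frac{n^2-2n}{8}$ if $n$ is even.
   Context: $\mathbb{S}_n$ is the set of integer $n$-tuples $(s_1,\dots,s_n)$ with $0\le s_1\le s_2\le\dots\le s_n$, $\sum_{i=1}^k s_i\ge\binom{k}{2}$ for $1\le k\le n$, and $\sum_{i=1}^n s_i=\binom{n}{2}$. $R_n$ denotes the $n$-tuple all of whose entries are $\frac{n-1}{2}$ if $n$ is odd, and the $n$-tuple whose first $n/2$ entries are $\frac{n-2}{2}$ and whose last $n/2$ entries are $\frac{n}{2}$ if $n$ is even. For $n$-tuples $S=(s_i)$ and $S'=(s_i')$, $d(S,S')=\sum_{i=1}^n|s_i-s_i'|$. Algorithm: begin with $S_0\in\mathbb{S}_n$, $S_0\neq R_n$. Given $S_l=(s_1,\dots,s_n)\ne R_n$ with $l\ge 0$, let $p<q$ be the indices with $s_1=s_2=\dots=s_p<s_{p+1}$ and $s_{q-1}<s_q=s_{q+1}=\dots=s_n$ (possibly $p=1$ or $q=n$); let $S_{l+1}$ be obtained from $S_l$ by replacing $s_p$ with $s_p+1$ and $s_q$ with $s_q-1$. If $S_{l+1}=R_n$, stop; otherwise repeat with $S_{l+1}$ in place of $S_l$. *)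

theory Defs
  imports Complex_Main
begin

text \<open>Integer \<open>n\<close>-tuples are lists of length \<open>n\<close>, so the entry \<open>s\<^sub>i\<close> (\<open>1 \<le> i \<le> n\<close>) is \<open>S ! (i - 1)\<close>.\<close>

definition score_seqs :: "nat \<Rightarrow> int list set" where
  "score_seqs n = {S. length S = n \<and> (\<forall>x\<in>set S. 0 \<le> x) \<and> sorted S
      \<and> (\<forall>k\<in>{1..n}. int (k choose 2) \<le> (\<Sum>i<k. S ! i))
      \<and> (\<Sum>i<n. S ! i) = int (n choose 2)}"

text \<open>Both integer divisions below are exact in the case where they are used.\<close>

definition R_seq :: "nat \<Rightarrow> int list" where
  "R_seq n = (if odd n then replicate n ((int n - 1) div 2)
     else replicate (n div 2) ((int n - 2) div 2) @ replicate (n div 2) (int n div 2))"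

definition Tr_seq :: "nat \<Rightarrow> int list" where
  "Tr_seq n = map int [0..<n]"

text \<open>Only meant for lists of equal length.\<close>

definition tuple_dist :: "int list \<Rightarrow> int list \<Rightarrow> int" where
  "tuple_dist S S' = (\<Sum>i<length S. \<bar>S ! i - S' ! i\<bar>)"

text \<open>The indices \<open>p\<close>, \<open>q\<close> are shifted down by one. They are uniquely determined by \<open>S\<close>.\<close>

definition jump :: "int list \<Rightarrow> int list \<Rightarrow> bool" where
  "jump S S' \<longleftrightarrow> (\<exists>p q. p < q \<and> q < length S
      \<and> (\<forall>i\<le>p. S ! i = S ! 0) \<and> S ! p < S ! (p + 1)
      \<and> S ! (q - 1) < S ! q \<and> (\<forall>i\<in>{q..<length S}. S ! i = S ! q)
      \<and> S' = S[p := S ! p + 1, q := S ! q - 1])"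

definition alg_step :: "nat \<Rightarrow> int list \<Rightarrow> int list \<Rightarrow> bool" where
  "alg_step n S S' \<longleftrightarrow> S \<noteq> R_seq n \<and> jump S S'"

text \<open>No step leaves \<open>R_seq n\<close>, so \<open>R_seq n\<close> is reached for the first time after the \<open>k\<close>-th jump.\<close>

definition stops_after :: "nat \<Rightarrow> int list \<Rightarrow> nat \<Rightarrow> bool" where
  "stops_after n S\<^sub>0 k \<longleftrightarrow> (alg_step n ^^ k) S\<^sub>0 (R_seq n)"

definition jump_counts :: "nat \<Rightarrow> nat set" where
  "jump_counts n = {k. \<exists>S\<^sub>0\<in>score_seqs n. S\<^sub>0 \<noteq> R_seq n \<and> stops_after n S\<^sub>0 k}"

end

theory Submission
  imports Defs
begin

text \<open>
  The number of jumps made from \<open>S\<close> is the total shortfall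
  \<open>\<Sum>i<n. max 0 (R\<^sub>i - s\<^sub>i)\<close> of \<open>S\<close> below \<open>R\<^sub>n\<close> (indices start at 0), which is half of \<open>d(S, R\<^sub>n)\<close> because both
  tuples have the same sum. What makes this work is that \<open>R\<^sub>n\<close> is sorted and its entries lie
  in \<open>{m, m + 1}\<close> with \<open>m = (n - 1) div 2\<close>. Hence, as long as \<open>S \<noteq> R\<^sub>n\<close>, the
  raised entry \<open>s\<^sub>p\<close> lies strictly below \<open>R\<^sub>p\<close> and the lowered entry \<open>s\<^sub>q\<close> strictly above \<open>R\<^sub>q\<close>:
  otherwise \<open>S\<close> would dominate \<open>R\<^sub>n\<close> entrywise, or be dominated by it, and having the same sum would
  coincide with it (\<open>jump_ends_apart\<close>). So each jump removes exactly one unit of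
  shortfall (\<open>deficit_jump\<close>), keeps the tuple sorted and keeps its sum
  (\<open>jump_sorted\<close>, \<open>jump_sum\<close>). A jump is possible unless \<open>S = R\<^sub>n\<close> (\<open>jump_exists\<close>), so
  exactly \<open>deficit R\<^sub>n S\<close> jumps are made (\<open>stops_after_iff\<close>).

  It remains to maximise the shortfall. The entries of a sorted \<open>S\<close> that are at most \<open>m\<close> form an
  initial segment of some length \<open>k\<close>, and all shortfall occurs there. Its total is
  \<open>(\<Sum>i<k. R\<^sub>i) - (\<Sum>i<k. s\<^sub>i)\<close>, and the score condition on prefix sums bounds this by
  \<open>\<Sum>i<k. (R\<^sub>i - i)\<close>, which is at most the shortfall of \<open>Tr\<^sub>n\<close> (\<open>deficit_le_deficit_Tr\<close>).
  The latter is \<open>\<Sum>i<m. (m - i) = m (m + 1) / 2\<close>.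
\<close>

section \<open>Shortfall below a nearly constant tuple\<close>

definition deficit :: "int list \<Rightarrow> int list \<Rightarrow> int" where
  "deficit R S = (\<Sum>i<length R. max 0 (R ! i - S ! i))"

lemma tuple_dist_eq_deficit:
  assumes "length S = length R" "(\<Sum>i<length R. S ! i) = (\<Sum>i<length R. R ! i)"
  shows "tuple_dist R S = 2 * deficit R S"
proof -
  have "tuple_dist R S = (\<Sum>i<length R. 2 * max 0 (R ! i - S ! i) - (R ! i - S ! i))"
    unfolding tuple_dist_def by (rule sum.cong) (simp_all add: max_def)
  then show ?thesis
    using assms(2) by (simp add: deficit_def sum_subtractf sum_distrib_left)
qed

lemma eq_if_dominated_same_sum:
  fixes R S :: "int list"
  assumes "length S = length R" and "(\<Sum>i<length R. S ! i) = (\<Sum>i<length R. R ! i)"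
    and "\<And>i. i < length R \<Longrightarrow> R ! i \<le> S ! i"
  shows "S = R"
proof (rule nth_equalityI)
  fix i assume "i < length S"
  have "(\<Sum>i<length R. S ! i - R ! i) = 0"
    using assms(2) by (simp add: sum_subtractf)
  then have "\<forall>i\<in>{..<length R}. S ! i - R ! i = 0"
    by (subst (asm) sum_nonneg_eq_0_iff) (use assms(3) in auto)
  then show "S ! i = R ! i"
    using \<open>i < length S\<close> assms(1) by auto
qed (use assms in simp)

text \<open>Sortedness and having at most two, consecutive, values is all that matters about \<open>R\<^sub>n\<close> for
  the effect of a jump; the parity of \<open>n\<close> does not enter.\<close>

locale nearly_constant_target =
  fixes R :: "int list" and m :: int
  assumes sorted_R: "sorted R"
    and R_ge: "\<And>i. i < length R \<Longrightarrow> m \<le> R ! i"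
    and R_le: "\<And>i. i < length R \<Longrightarrow> R ! i \<le> m + 1"
begin

definition balanced :: "int list \<Rightarrow> bool" where
  "balanced S \<longleftrightarrow> length S = length R \<and> sorted S \<and> (\<Sum>i<length R. S ! i) = (\<Sum>i<length R. R ! i)"

lemma eq_if_ge:
  assumes "balanced S" "\<And>i. i < length R \<Longrightarrow> R ! i \<le> S ! i"
  shows "S = R"
  using assms eq_if_dominated_same_sum[of S R] unfolding balanced_def by auto

lemma eq_if_le:
  assumes "balanced S" "\<And>i. i < length R \<Longrightarrow> S ! i \<le> R ! i"
  shows "S = R"
  using assms eq_if_dominated_same_sum[of R S] unfolding balanced_def by auto

text \<open>A constant tuple lies entirely on one side of the gap between \<open>m\<close> and \<open>m + 1\<close>, so it is
  comparable with \<open>R\<close>; hence a balanced tuple other than \<open>R\<close> has two distinct values, and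
  the ends of its extreme blocks are the positions of a jump.\<close>

lemma jump_exists:
  assumes "balanced S" "S \<noteq> R"
  shows "\<exists>S'. jump S S'"
proof -
  let ?n = "length S"
  have len: "?n = length R" and srt: "sorted S"
    using assms(1) by (auto simp: balanced_def)
  have mono: "S ! i \<le> S ! j" if "i \<le> j" "j < ?n" for i j
    using srt that by (simp add: sorted_nth_mono)
  have n0: "0 < ?n"
    using assms(2) len by auto
  have ends: "S ! 0 < S ! (?n - 1)"
  proof (rule ccontr)
    assume "\<not> ?thesis"
    then have const: "S ! i = S ! 0" if "i < ?n" for i
      using mono[of 0 i] mono[of i "?n - 1"] that n0 by fastforce
    show False
    proof (cases "S ! 0 \<le> m")
      case True
      then have "S = R"
        by (intro eq_if_le[OF assms(1)]) (metis const R_ge len order_trans)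
      with assms(2) show False ..
    next
      case False
      then have "m + 1 \<le> S ! 0"
        by simp
      then have "S = R"
        by (intro eq_if_ge[OF assms(1)]) (metis const R_le len order_trans)
      with assms(2) show False ..
    qed
  qed
  define p1 where "p1 = (LEAST i. i < ?n \<and> S ! i \<noteq> S ! 0)"
  define q where "q = (LEAST i. i < ?n \<and> S ! i = S ! (?n - 1))"
  have p1: "p1 < ?n \<and> S ! p1 \<noteq> S ! 0"
    unfolding p1_def by (rule LeastI[of _ "?n - 1"]) (use ends n0 in auto)
  have p1_min: "S ! i = S ! 0" if "i < p1" for i
    using not_less_Least[of i "\<lambda>i. i < ?n \<and> S ! i \<noteq> S ! 0"] that p1 unfolding p1_def by auto
  have q: "q < ?n \<and> S ! q = S ! (?n - 1)"
    unfolding q_def by (rule LeastI[of _ "?n - 1"]) (use n0 in auto)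
  have q_min: "S ! i \<noteq> S ! q" if "i < q" for i
    using not_less_Least[of i "\<lambda>i. i < ?n \<and> S ! i = S ! (?n - 1)"] that q unfolding q_def by auto
  have "p1 \<noteq> 0" "q \<noteq> 0"
    using p1 q ends by (metis, metis less_irrefl)
  have "p1 \<le> q"
    using p1_min[of q] q ends by (cases "q < p1") auto
  have "S ! (q - 1) \<le> S ! q" "S ! (q - 1) \<noteq> S ! q"
    using mono[of "q - 1" q] q q_min[of "q - 1"] \<open>q \<noteq> 0\<close> by auto
  then have "S ! (q - 1) < S ! q"
    by simp
  moreover obtain p where p: "p1 = p + 1"
    using \<open>p1 \<noteq> 0\<close> by (metis Suc_eq_plus1 not0_implies_Suc)
  moreover have "S ! p < S ! (p + 1)"
    using p1_min[of p] p p1 mono[of 0 p1] by auto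
  moreover have "\<forall>i\<in>{q..<?n}. S ! i = S ! q"
  proof
    fix i assume "i \<in> {q..<?n}"
    then have "q \<le> i" "i \<le> ?n - 1" "i < ?n"
      by auto
    then show "S ! i = S ! q"
      using mono[of q i] mono[of i "?n - 1"] q by simp
  qed
  moreover have "\<forall>i\<le>p. S ! i = S ! 0"
    using p by (auto intro: p1_min)
  moreover have "p < q" "q < ?n"
    using \<open>p1 \<le> q\<close> p q by simp_all
  ultimately have "jump S (S[p := S ! p + 1, q := S ! q - 1])"
    unfolding jump_def by blast
  then show ?thesis ..
qed

text \<open>If \<open>s\<^sub>p\<close> were not below \<open>R\<^sub>p\<close>, the entries after its block would be at least \<open>m + 1\<close>
  and those in the block at least \<open>R\<^sub>p\<close>, so \<open>S\<close> would dominate \<open>R\<close>. The argument for \<open>q\<close> is dual.\<close>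

lemma jump_ends_apart:
  assumes "balanced S" "S \<noteq> R" and pq: "p < q" "q < length S"
    and p: "\<forall>i\<le>p. S ! i = S ! 0" "S ! p < S ! (p + 1)"
    and q: "S ! (q - 1) < S ! q" "\<forall>i\<in>{q..<length S}. S ! i = S ! q"
  shows "S ! p < R ! p" "R ! q < S ! q"
proof -
  have len: "length S = length R" and srt: "sorted S"
    using assms(1) by (auto simp: balanced_def)
  have mono: "S ! i \<le> S ! j" if "i \<le> j" "j < length S" for i j
    using srt that by (simp add: sorted_nth_mono)
  have monoR: "R ! i \<le> R ! j" if "i \<le> j" "j < length S" for i j
    using sorted_R that len by (simp add: sorted_nth_mono)
  show "S ! p < R ! p"
  proof (rule ccontr)
    assume neg: "\<not> ?thesis"
    have "R ! i \<le> S ! i" if i: "i < length R" for i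
    proof (cases "i \<le> p")
      case True
      have "S ! i = S ! 0" "S ! p = S ! 0"
        using p(1) True by blast+
      then show ?thesis
        using neg monoR[of i p] True pq by simp
    next
      case False
      then have "S ! (p + 1) \<le> S ! i"
        using mono[of "p + 1" i] i len by simp
      then show ?thesis
        using neg p(2) R_ge[of p] R_le[OF i] pq len by simp
    qed
    then show False
      using eq_if_ge assms(1,2) by blast
  qed
  show "R ! q < S ! q"
  proof (rule ccontr)
    assume neg: "\<not> ?thesis"
    have "S ! i \<le> R ! i" if i: "i < length R" for i
    proof (cases "q \<le> i")
      case True
      then have "i \<in> {q..<length S}"
        using i len by simp
      then have "S ! i = S ! q"
        using q(2) by blast
      then show ?thesis
        using neg monoR[of q i] True i len by simp
    next
      case False
      then have "S ! i \<le> S ! (q - 1)"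
        using mono[of i "q - 1"] pq by simp
      then show ?thesis
        using neg q(1) R_ge[OF i] R_le[of q] pq len by simp
    qed
    then show False
      using eq_if_le assms(1,2) by blast
  qed
qed

context
  fixes S p q S'
  assumes bal: "balanced S" and apart: "S ! p < R ! p" "R ! q < S ! q"
    and pq: "p < q" "q < length S"
    and S': "S' = S[p := S ! p + 1, q := S ! q - 1]"
begin

lemma S'_nth: "i < length S \<Longrightarrow>
    S' ! i = S ! i + (if i = p then 1 else 0) - (if i = q then 1 else 0)"
  using pq unfolding S' by (auto simp: nth_list_update)

text \<open>The two changed entries cannot pass each other, even when adjacent:
  \<open>s\<^sub>p + 1 \<le> R\<^sub>p \<le> R\<^sub>q \<le> s\<^sub>q - 1\<close>.\<close>

lemma jump_sorted:
  assumes "S ! p < S ! (p + 1)" "S ! (q - 1) < S ! q"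
  shows "sorted S'"
proof -
  have len: "length S = length R" and srt: "sorted S"
    using bal by (auto simp: balanced_def)
  have len': "length S' = length S"
    by (simp add: S')
  have mono: "S ! i \<le> S ! j" if "i \<le> j" "j < length S" for i j
    using srt that by (simp add: sorted_nth_mono)
  have "R ! p \<le> R ! q"
    using sorted_R pq len by (simp add: sorted_nth_mono)
  then have gap: "S ! p + 2 \<le> S ! q"
    using apart by simp
  have "S' ! i \<le> S' ! j" if ij: "i < j" "j < length S'" for i j
  proof -
    have up: "S ! p + 1 \<le> S ! j" if "i = p"
      using mono[of "p + 1" j] assms(1) ij that len' by auto
    have down: "S ! i \<le> S ! q - 1" if "j = q"
      using mono[of i "q - 1"] assms(2) ij that pq by fastforce
    show ?thesis
      using mono[of i j] up down gap ij len' pq by (auto simp: S'_nth)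
  qed
  then show ?thesis
    by (auto simp: sorted_iff_nth_mono_less)
qed

lemma jump_sum: "(\<Sum>i<length R. S' ! i) = (\<Sum>i<length R. S ! i)"
proof -
  have len: "length S = length R"
    using bal by (auto simp: balanced_def)
  have "(\<Sum>i<length R. S' ! i)
      = (\<Sum>i<length R. S ! i + (if i = p then 1 else 0) - (if i = q then 1 else 0))"
    using len by (intro sum.cong) (auto simp: S'_nth)
  also have "\<dots> = (\<Sum>i<length R. S ! i)"
    using pq len by (simp add: sum_subtractf sum.distrib)
  finally show ?thesis .
qed

lemma deficit_jump: "deficit R S = deficit R S' + 1"
proof -
  have len: "length S = length R"
    using bal by (auto simp: balanced_def)
  have "deficit R S = (\<Sum>i<length R. max 0 (R ! i - S' ! i) + (if i = p then 1 else 0))"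
    unfolding deficit_def using len apart pq by (intro sum.cong) (auto simp: S'_nth)
  then show ?thesis
    using pq len by (simp add: deficit_def sum.distrib)
qed

end

lemma jump_balanced_deficit:
  assumes "balanced S" "S \<noteq> R" "jump S S'"
  shows "balanced S'" "deficit R S = deficit R S' + 1"
proof -
  obtain p q where pq: "p < q" "q < length S"
    and p: "\<forall>i\<le>p. S ! i = S ! 0" "S ! p < S ! (p + 1)"
    and q: "S ! (q - 1) < S ! q" "\<forall>i\<in>{q..<length S}. S ! i = S ! q"
    and S': "S' = S[p := S ! p + 1, q := S ! q - 1]"
    using assms(3) unfolding jump_def by blast
  note apart = jump_ends_apart[OF assms(1,2) pq p q]
  have "length S' = length S"
    by (simp add: S')
  then show "balanced S'"
    using jump_sorted[OF assms(1) apart pq S' p(2) q(1)] jump_sum[OF assms(1) apart pq S']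
      assms(1) by (simp add: balanced_def)
  show "deficit R S = deficit R S' + 1"
    by (rule deficit_jump[OF assms(1) apart pq S'])
qed

lemma deficit_nonneg: "0 \<le> deficit R S"
  unfolding deficit_def by (intro sum_nonneg) auto

lemma eq_if_deficit_0:
  assumes "balanced S" "deficit R S = 0"
  shows "S = R"
proof (rule eq_if_ge[OF assms(1)])
  fix i assume "i < length R"
  have "\<forall>i\<in>{..<length R}. max 0 (R ! i - S ! i) = 0"
    using assms(2) unfolding deficit_def by (subst (asm) sum_nonneg_eq_0_iff) auto
  then have "max 0 (R ! i - S ! i) = 0"
    using \<open>i < length R\<close> by blast
  then show "R ! i \<le> S ! i"
    by linarith
qed

lemma relpowp_jump_iff_deficit:
  assumes "balanced S"
  shows "((\<lambda>S S'. S \<noteq> R \<and> jump S S') ^^ k) S R \<longleftrightarrow> int k = deficit R S"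
  using assms
proof (induction k arbitrary: S)
  case 0
  show ?case
    using eq_if_deficit_0[OF 0] by (auto simp: deficit_def)
next
  case (Suc k)
  let ?J = "\<lambda>S S'. S \<noteq> R \<and> jump S S'"
  show ?case
  proof
    assume "(?J ^^ Suc k) S R"
    then obtain T where T: "S \<noteq> R" "jump S T" "(?J ^^ k) T R"
      by (blast elim: relpowp_Suc_E2)
    from jump_balanced_deficit[OF Suc.prems T(1,2)] Suc.IH[of T] T(3)
    show "int (Suc k) = deficit R S"
      by simp
  next
    assume k: "int (Suc k) = deficit R S"
    then have "S \<noteq> R"
      by (auto simp: deficit_def)
    then obtain T where T: "jump S T"
      using jump_exists Suc.prems by blast
    from jump_balanced_deficit[OF Suc.prems \<open>S \<noteq> R\<close> T] Suc.IH[of T] k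
    have "(?J ^^ k) T R"
      by simp
    then show "(?J ^^ Suc k) S R"
      using \<open>S \<noteq> R\<close> T by (blast intro: relpowp_Suc_I2)
  qed
qed

end

section \<open>The regular score sequence and the transitive one\<close>

lemma length_R_seq [simp]: "length (R_seq n) = n"
proof (cases "odd n")
  case False
  then have "n div 2 + n div 2 = n"
    by (metis even_two_times_div_two mult_2)
  with False show ?thesis
    by (simp add: R_seq_def)
qed (simp add: R_seq_def)

lemma R_seq_nth:
  assumes "i < n"
  shows "R_seq n ! i = (if 2 * i < n then (int n - 1) div 2 else int n div 2)"
proof (cases "odd n")
  case True
  then obtain h where "n = 2 * h + 1" by (elim oddE)
  then show ?thesis
    using assms by (simp add: R_seq_def del: replicate_Suc)
next
  case False
  then have "even n" by simp
  then obtain h where "n = 2 * h" by (elim evenE)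
  then show ?thesis
    using assms by (auto simp: R_seq_def nth_append)
qed

lemma sum_int_lessThan: "(\<Sum>i<k. int i) = int (k choose 2)"
  by (induction k) (simp_all add: numeral_2_eq_2)

lemma double_choose_two: "2 * int (k choose 2) = int k * (int k - 1)"
  by (induction k) (simp_all add: numeral_2_eq_2 algebra_simps)

lemma sum_R_seq: "(\<Sum>i<n. R_seq n ! i) = int (n choose 2)"
proof (cases "odd n")
  case True
  then obtain h where h: "n = 2 * h + 1" by (elim oddE)
  have "(\<Sum>i<n. R_seq n ! i) = (\<Sum>i<n. int h)"
    by (rule sum.cong) (auto simp: R_seq_nth h)
  then show ?thesis
    using double_choose_two[of n] by (simp add: h algebra_simps)
next
  case False
  then have "even n" by simp
  then obtain h where h: "n = 2 * h" by (elim evenE)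
  have "(\<Sum>i<n. R_seq n ! i) = (\<Sum>i<h + h. int h - (if i < h then 1 else 0))"
    by (rule sum.cong) (auto simp: R_seq_nth h)
  also have "\<dots> = int (h + h) * int h - int (card ({..<h + h} \<inter> {i. i < h}))"
    by (simp add: sum_subtractf sum.If_cases)
  also have "{..<h + h} \<inter> {i. i < h} = {..<h}"
    by auto
  finally show ?thesis
    using double_choose_two[of n] by (simp add: h algebra_simps)
qed

lemma nearly_constant_R_seq: "nearly_constant_target (R_seq n) ((int n - 1) div 2)"
  by unfold_locales (auto simp: sorted_iff_nth_mono R_seq_nth)

lemma score_seqs_balanced:
  assumes "S \<in> score_seqs n"
  shows "nearly_constant_target.balanced (R_seq n) S"
  using assms by (simp add: nearly_constant_target.balanced_def[OF nearly_constant_R_seq]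
      score_seqs_def sum_R_seq)

lemma stops_after_iff:
  assumes "S \<in> score_seqs n"
  shows "stops_after n S k \<longleftrightarrow> int k = deficit (R_seq n) S"
proof -
  have "alg_step n = (\<lambda>S S'. S \<noteq> R_seq n \<and> jump S S')"
    by (simp add: alg_step_def fun_eq_iff)
  then show ?thesis
    using nearly_constant_target.relpowp_jump_iff_deficit
      [OF nearly_constant_R_seq score_seqs_balanced[OF assms]]
    by (simp add: stops_after_def)
qed

lemma Tr_seq_nth [simp]: "i < n \<Longrightarrow> Tr_seq n ! i = int i"
  by (simp add: Tr_seq_def)

lemma length_Tr_seq: "length (Tr_seq n) = n"
  by (simp add: Tr_seq_def)

lemma Tr_in_score_seqs: "Tr_seq n \<in> score_seqs n"
proof -
  have "sorted (Tr_seq n)" "\<forall>x\<in>set (Tr_seq n). 0 \<le> x"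
    by (auto simp: Tr_seq_def sorted_iff_nth_mono)
  then show ?thesis
    by (simp add: score_seqs_def length_Tr_seq sum_int_lessThan)
qed

text \<open>For \<open>i \<le> m\<close> the entry \<open>R\<^sub>i\<close> is \<open>m\<close>, and for \<open>i > m\<close> it satisfies \<open>R\<^sub>i \<le> m + 1 \<le> i\<close>, so
  only the triangle \<open>m + (m - 1) + \<dots> + 1\<close> remains.\<close>

lemma deficit_Tr:
  assumes "n \<ge> 1"
  shows "2 * deficit (R_seq n) (Tr_seq n) = int ((n - 1) div 2) * (int ((n - 1) div 2) + 1)"
proof -
  define m where "m = (n - 1) div 2"
  have m: "(int n - 1) div 2 = int m" "m < n"
    using assms by (auto simp: m_def of_nat_diff zdiv_int)
  have "deficit (R_seq n) (Tr_seq n) = (\<Sum>i<n. if i < m then int m - int i else 0)"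
    unfolding deficit_def length_R_seq
  proof (rule sum.cong)
    fix i assume "i \<in> {..<n}"
    then show "max 0 (R_seq n ! i - Tr_seq n ! i) = (if i < m then int m - int i else 0)"
      using m by (auto simp: R_seq_nth)
  qed simp
  also have "\<dots> = (\<Sum>i\<in>{..<n} \<inter> {i. i < m}. int m - int i)"
    by (simp add: sum.inter_restrict)
  also have "{..<n} \<inter> {i. i < m} = {..<m}"
    using m(2) by auto
  finally show ?thesis
    unfolding m_def[symmetric] using double_choose_two[of m]
    by (simp add: sum_subtractf sum_int_lessThan algebra_simps)
qed

text \<open>Cutting at the last entry that is at most \<open>m\<close> separates the indices with \<open>s\<^sub>i \<le> R\<^sub>i\<close> from those
  with \<open>s\<^sub>i \<ge> R\<^sub>i\<close>, which turns the shortfall into a difference of prefix sums.\<close>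

lemma deficit_le_deficit_Tr:
  assumes "S \<in> score_seqs n"
  shows "deficit (R_seq n) S \<le> deficit (R_seq n) (Tr_seq n)"
proof -
  let ?R = "R_seq n" and ?m = "(int n - 1) div 2"
  interpret nearly_constant_target ?R ?m
    by (rule nearly_constant_R_seq)
  have len: "length S = n" and srt: "sorted S"
    and prefix: "\<And>k. k \<in> {1..n} \<Longrightarrow> int (k choose 2) \<le> (\<Sum>i<k. S ! i)"
    using assms by (auto simp: score_seqs_def)
  define k where "k = (LEAST k. k = n \<or> ?m < S ! k)"
  have k: "k = n \<or> ?m < S ! k"
    unfolding k_def by (rule LeastI[of _ n]) simp
  have kn: "k \<le> n"
    unfolding k_def by (rule Least_le) simp
  have below: "S ! i \<le> R_seq n ! i" if "i < k" for i
    using not_less_Least[of i "\<lambda>k. k = n \<or> ?m < S ! k"] that R_ge[of i] kn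
    unfolding k_def[symmetric] by auto
  have above: "R_seq n ! i \<le> S ! i" if "k \<le> i" "i < n" for i
  proof -
    have "S ! k \<le> S ! i"
      using srt that len by (simp add: sorted_nth_mono)
    then show ?thesis
      using k that R_le[of i] by auto
  qed
  have "deficit ?R S = (\<Sum>i<k. max 0 (?R ! i - S ! i))"
    unfolding deficit_def using kn above by (intro sum.mono_neutral_right) auto
  also have "\<dots> = (\<Sum>i<k. ?R ! i) - (\<Sum>i<k. S ! i)"
    using below by (simp flip: sum_subtractf)
  also have "\<dots> \<le> (\<Sum>i<k. ?R ! i) - int (k choose 2)"
    using prefix[of k] kn by (cases "k = 0") auto
  also have "\<dots> = (\<Sum>i<k. ?R ! i - Tr_seq n ! i)"
    using kn by (simp add: sum_subtractf sum_int_lessThan)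
  also have "\<dots> \<le> (\<Sum>i<k. max 0 (?R ! i - Tr_seq n ! i))"
    by (intro sum_mono) simp
  also have "\<dots> \<le> deficit ?R (Tr_seq n)"
    unfolding deficit_def using kn by (intro sum_mono2) auto
  finally show ?thesis .
qed

section \<open>The maximal number of jumps\<close>

theorem mainTheorem2:
  fixes n :: nat
  assumes "n \<ge> 3"
  shows "(\<forall>S\<^sub>0\<in>score_seqs n. S\<^sub>0 \<noteq> R_seq n \<longrightarrow> (\<exists>!k. stops_after n S\<^sub>0 k))
    \<and> finite (jump_counts n) \<and> jump_counts n \<noteq> {}
    \<and> real (Max (jump_counts n)) = 1 / 2 * real_of_int (tuple_dist (R_seq n) (Tr_seq n))
    \<and> 1 / 2 * real_of_int (tuple_dist (R_seq n) (Tr_seq n)) =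
        (if odd n then ((real n)\<^sup>2 - 1) / 8 else ((real n)\<^sup>2 - 2 * real n) / 8)"
proof (intro conjI)
  let ?D = "deficit (R_seq n)"
  let ?M = "nat (?D (Tr_seq n))"
  have nonneg: "0 \<le> ?D S" for S
    by (rule nearly_constant_target.deficit_nonneg[OF nearly_constant_R_seq])
  have count: "stops_after n S k \<longleftrightarrow> k = nat (?D S)" if "S \<in> score_seqs n" for S k
    using stops_after_iff[OF that] nonneg[of S] by (metis nat_0_le nat_int)
  show "\<forall>S\<^sub>0\<in>score_seqs n. S\<^sub>0 \<noteq> R_seq n \<longrightarrow> (\<exists>!k. stops_after n S\<^sub>0 k)"
    by (simp add: count)
  have "Tr_seq n ! 0 \<noteq> R_seq n ! 0"
    using assms by (simp add: R_seq_nth)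
  then have "Tr_seq n \<noteq> R_seq n"
    by metis
  then have attained: "?M \<in> jump_counts n"
    unfolding jump_counts_def using count[OF Tr_in_score_seqs] Tr_in_score_seqs[of n] by blast
  have bound: "k \<le> ?M" if "k \<in> jump_counts n" for k
  proof -
    obtain S where S: "S \<in> score_seqs n" "stops_after n S k"
      using \<open>k \<in> jump_counts n\<close> unfolding jump_counts_def by blast
    then have "k = nat (?D S)"
      using count by blast
    then show ?thesis
      using deficit_le_deficit_Tr[OF S(1)] by simp
  qed
  show fin: "finite (jump_counts n)"
    using bound by (meson finite_nat_set_iff_bounded_le)
  show "jump_counts n \<noteq> {}"
    using attained by blast
  have dist: "tuple_dist (R_seq n) (Tr_seq n) = 2 * ?D (Tr_seq n)"
    by (rule tuple_dist_eq_deficit) (simp_all add: length_Tr_seq sum_int_lessThan sum_R_seq)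
  have "Max (jump_counts n) = ?M"
    using fin bound attained by (rule Max_eqI)
  then show "real (Max (jump_counts n)) = 1 / 2 * real_of_int (tuple_dist (R_seq n) (Tr_seq n))"
    using nonneg[of "Tr_seq n"] by (simp add: dist)
  have val: "tuple_dist (R_seq n) (Tr_seq n) = int ((n - 1) div 2) * (int ((n - 1) div 2) + 1)"
    using deficit_Tr[of n] assms dist by simp
  show "1 / 2 * real_of_int (tuple_dist (R_seq n) (Tr_seq n)) =
      (if odd n then ((real n)\<^sup>2 - 1) / 8 else ((real n)\<^sup>2 - 2 * real n) / 8)"
  proof (cases "odd n")
    case True
    then obtain h where h: "n = 2 * h + 1" by (elim oddE)
    then have "(n - 1) div 2 = h"
      by simp
    then show ?thesis
      unfolding val using h by (simp add: power2_eq_square field_simps)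
  next
    case False
    then obtain h where h: "n = 2 * Suc h"
      using assms by (metis evenE mult_0_right not0_implies_Suc not_numeral_le_zero)
    then have "(n - 1) div 2 = h"
      by simp
    then show ?thesis
      unfolding val using h by (simp add: power2_eq_square field_simps)
  qed
qed

end
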